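(* Suppose that the dual of (P) has the error bound property. Let $(x^k,u^k)_{k\ge0}$ be generated by Algorithm (DG) with constant step size $\alpha_k=1/L_{\mathrm d}$. Then the last primal iterate $u^k$ is an $\epsilon$-primal solution of (P) after $k=\mathcal{O}(\log(1/\epsilon))$ iterations; that is, there exist constants $C_1,C_2>0$, independent of $\epsilon$ and $k$, such that for every $\epsilon\in(0,1)$ and every integer $k\ge1$ with $k\ge C_1\log(1/\epsilon)$, $$\mathrm{dist}_{\mathcal{K}}(Gu^k+g)\le C_2\,\epsilon \quad\text{and}\quad -C_2\,\epsilon\le f(u^k)-f^*\le C_2\,\epsilon .$$
   Context: Problem (P): $f^* = \min_{u \in U} f(u)$ subject to $Gu + g \in \mathcal{K}$, where $f:\mathbb{R}^n \to \mathbb{R}$ is $\sigma_{\mathrm f}$-strongly convex with respect to the Euclidean norm $\|\cdot\|$ ($\sigma_{\mathrm f}>0$), $G \in \mathbb{R}^{p\times n}$ ($G\ne 0$), $g \in \mathbb{R}^p$, $\mathcal{K}\subseteq\mathbb{R}^p$ is a proper cone (closed, convex, pointed, nonempty interior), and $U \subseteq \mathbb{R}^n$ is a nonempty closed convex set. $\mathcal{K}^* = \{x : \langle x,z\rangle \ge 0\ \forall z\in\mathcal{K}\}$ is the dual cone. The Lagrangian is $\mathcal{L}(u,x) = f(u) - \langle x, Gu+g\rangle$, the dual function is $d(x) = \min_{u\in U}\mathcal{L}(u,x)$ for $x \in \mathbb{R}^p$, and $u(x)$ is the unique minimizer of $\mathcal{L}(\cdot,x)$ over $U$. The function $d$ is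 concave and differentiable on $\mathbb{R}^p$ with $\nabla d(x) = -Gu(x)-g$, Lipschitz with constant $L_{\mathrm d} = \|G\|^2/\sigma_{\mathrm f}$ ($\|G\|$ the spectral norm). Standing assumption: there exists a finite optimal Lagrange multiplier for the conic constraint, so that $f^* = \max_{x\in\mathcal{K}^*} d(x)$ and the set $X^*\subseteq\mathcal{K}^*$ of maximizers is nonempty. $[z]_C$ denotes Euclidean projection onto $C$, $\mathrm{dist}_C(z)=\min_{w\in C}\|w-z\|$; $\bar x=[x]_{X^*}$; the gradient map is $\nabla^+d(x)=\left[x+\frac1{L_{\mathrm d}}\nabla d(x)\right]_{\mathcal{K}^*}-x$. Error bound property: for every $M>0$ there exists $\kappa>0$ (depending on $M$ and the problem data) such that $\|x-\bar x\|\le\kappa\|\nabla^+d(x)\|$ for all $x\in\mathcal{K}^*$ with $f^*-d(x)\le M$. Algorithm (DG) with constant step size: given $x^0\in\mathcal{K}^*$, for $k\ge0$ compute $u^k=u(x^k)=\arg\min_{u\in U}\mathcal{L}(u,x^k)$ and $x^{k+1}=\left[x^k+\frac1{L_{\mathrm d}}\nabla d(x^k)\right]_{\mathcal{K}^*}$. $\tilde u\in U$ is an $\epsilon$-primal solution if $\mathrm{dist}_{\mathcal{K}}(G\tilde u+g)\le\mathcal{O}(\epsilon)$ and $-\mathcal{O}(\epsilon)\le f(\tilde u)-f^*\le\mathcal{O}(\epsilon)$; constants in $\mathcal{O}$ may depend on the problem data, $x^0$ and the error bound constant $\kappa$, but not on $\epsilon$ or $k$. *)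

theory Defs
  imports "HOL-Analysis.Analysis"
begin

definition strongly_convex :: "real \<Rightarrow> ('a::real_normed_vector \<Rightarrow> real) \<Rightarrow> bool" where
  "strongly_convex \<sigma> f \<longleftrightarrow>
     (\<forall>x y. \<forall>t\<in>{0..1}. f ((1 - t) *\<^sub>R x + t *\<^sub>R y)
        \<le> (1 - t) * f x + t * f y - \<sigma> / 2 * t * (1 - t) * (norm (x - y))\<^sup>2)"

definition proper_cone :: "'a::euclidean_space set \<Rightarrow> bool" where
  "proper_cone K \<longleftrightarrow>
     cone K \<and> closed K \<and> convex K \<and> K \<inter> uminus ` K = {0} \<and> interior K \<noteq> {}"

definition dual_cone :: "'a::real_inner set \<Rightarrow> 'a set" where
  "dual_cone K = {x. \<forall>z\<in>K. 0 \<le> x \<bullet> z}"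

definition lagrangian ::
  "(real^'n \<Rightarrow> real) \<Rightarrow> real^'n^'p \<Rightarrow> real^'p \<Rightarrow> real^'n \<Rightarrow> real^'p \<Rightarrow> real" where
  "lagrangian f G g u x = f u - x \<bullet> (G *v u + g)"

(* For strongly convex f and nonempty closed convex U the infimum is attained, by a unique u. *)
definition dual_fun ::
  "(real^'n \<Rightarrow> real) \<Rightarrow> real^'n^'p \<Rightarrow> real^'p \<Rightarrow> (real^'n) set \<Rightarrow> real^'p \<Rightarrow> real" where
  "dual_fun f G g U x = (INF u\<in>U. lagrangian f G g u x)"

definition feasible_set ::
  "real^'n^'p \<Rightarrow> real^'p \<Rightarrow> (real^'p) set \<Rightarrow> (real^'n) set \<Rightarrow> (real^'n) set" where
  "feasible_set G g K U = {u \<in> U. G *v u + g \<in> K}"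

(* Real-valued, hence meaningful only for a feasible problem. Feasibility follows as soon as
   the dual function has a maximizer over the dual cone, so it is not a separate condition. *)
definition opt_val ::
  "(real^'n \<Rightarrow> real) \<Rightarrow> real^'n^'p \<Rightarrow> real^'p \<Rightarrow> (real^'p) set \<Rightarrow> (real^'n) set \<Rightarrow> real" where
  "opt_val f G g K U = (INF u\<in>feasible_set G g K U. f u)"

definition dual_opt_set ::
  "(real^'n \<Rightarrow> real) \<Rightarrow> real^'n^'p \<Rightarrow> real^'p \<Rightarrow> (real^'p) set \<Rightarrow> (real^'n) set
    \<Rightarrow> (real^'p) set" where
  "dual_opt_set f G g K U = {x. is_arg_max (dual_fun f G g U) (\<lambda>x. x \<in> dual_cone K) x}"

definition gradient :: "('a::real_inner \<Rightarrow> real) \<Rightarrow> 'a \<Rightarrow> 'a" where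
  "gradient h x = (THE D. GDERIV h x :> D)"

(* onorm of the matrix map with respect to the Euclidean norms is the spectral norm of G. *)
definition lip_dual :: "real \<Rightarrow> real^'n^'p \<Rightarrow> real" where
  "lip_dual \<sigma> G = (onorm ((*v) G))\<^sup>2 / \<sigma>"

definition dual_gradient_step ::
  "real \<Rightarrow> (real^'n \<Rightarrow> real) \<Rightarrow> real^'n^'p \<Rightarrow> real^'p \<Rightarrow> (real^'p) set \<Rightarrow> (real^'n) set
    \<Rightarrow> real^'p \<Rightarrow> real^'p" where
  "dual_gradient_step \<sigma> f G g K U x =
     closest_point (dual_cone K)
       (x + (1 / lip_dual \<sigma> G) *\<^sub>R gradient (dual_fun f G g U) x)"

definition gradient_map ::
  "real \<Rightarrow> (real^'n \<Rightarrow> real) \<Rightarrow> real^'n^'p \<Rightarrow> real^'p \<Rightarrow> (real^'p) set \<Rightarrow> (real^'n) set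
    \<Rightarrow> real^'p \<Rightarrow> real^'p" where
  "gradient_map \<sigma> f G g K U x = dual_gradient_step \<sigma> f G g K U x - x"

definition error_bound_property ::
  "real \<Rightarrow> (real^'n \<Rightarrow> real) \<Rightarrow> real^'n^'p \<Rightarrow> real^'p \<Rightarrow> (real^'p) set \<Rightarrow> (real^'n) set
    \<Rightarrow> bool" where
  "error_bound_property \<sigma> f G g K U \<longleftrightarrow>
     (\<forall>M>0. \<exists>\<kappa>>0. \<forall>x\<in>dual_cone K. opt_val f G g K U - dual_fun f G g U x \<le> M \<longrightarrow>
        norm (x - closest_point (dual_opt_set f G g K U) x)
          \<le> \<kappa> * norm (gradient_map \<sigma> f G g K U x))"

definition DG_iterates ::
  "real \<Rightarrow> (real^'n \<Rightarrow> real) \<Rightarrow> real^'n^'p \<Rightarrow> real^'p \<Rightarrow> (real^'p) set \<Rightarrow> (real^'n) set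
    \<Rightarrow> (nat \<Rightarrow> real^'p) \<Rightarrow> (nat \<Rightarrow> real^'n) \<Rightarrow> bool" where
  "DG_iterates \<sigma> f G g K U x u \<longleftrightarrow>
     x 0 \<in> dual_cone K \<and>
     (\<forall>k. is_arg_min (\<lambda>v. lagrangian f G g v (x k)) (\<lambda>v. v \<in> U) (u k) \<and>
          x (Suc k) = dual_gradient_step \<sigma> f G g K U (x k))"

(* C is the constant hidden in the O(eps) bounds. *)
definition primal_solution ::
  "(real^'n \<Rightarrow> real) \<Rightarrow> real^'n^'p \<Rightarrow> real^'p \<Rightarrow> (real^'p) set \<Rightarrow> (real^'n) set
    \<Rightarrow> real \<Rightarrow> real \<Rightarrow> real^'n \<Rightarrow> bool" where
  "primal_solution f G g K U C \<epsilon> v \<longleftrightarrow>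
     v \<in> U \<and> infdist (G *v v + g) K \<le> C * \<epsilon> \<and>
     - (C * \<epsilon>) \<le> f v - opt_val f G g K U \<and> f v - opt_val f G g K U \<le> C * \<epsilon>"

end

theory Submission
  imports Defs
begin

text \<open>
  Write \<open>d\<close> for the dual function, \<open>F\<close> for the optimal value and \<open>L\<close> for \<open>lip_dual \<sigma> G\<close>. The dual
  gaps \<open>F - d (x k)\<close> decay geometrically, and the square root of the dual gap bounds every primal
  error of \<open>u k\<close>.

  Strong convexity of \<open>f\<close> makes the Lagrangian grow quadratically away from its minimizer \<open>u\<close> over
  \<open>U\<close>. Hence at every \<open>x\<close> the dual function lies below its tangent with slope \<open>- (G *v u + g)\<close> and
  above that tangent minus \<open>L / 2\<close> times the squared distance to \<open>x\<close> (\<open>dual_fun_sandwich\<close>). The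
  analysis of the dual iterates rests on this sandwich: it identifies the gradient, and it turns the variational
  inequality of the projection onto the dual cone into the three-point inequality \<open>projected_gradient_three_point\<close>. Comparing the new iterate with a fixed
  dual solution, that inequality keeps the iterates bounded. Comparing it with the old iterate, it
  shows that the squared step length is at most a multiple of the ascent. Comparing it with the
  projection of the old iterate onto the dual solution set, it bounds the new gap by the step length
  times the distance to that set, and the error bound property makes this a multiple of the squared
  step length. The last two facts together say that the new gap is at most a multiple of the decrease
  of the gap, which is linear convergence (\<open>projected_gradient_contraction\<close>). The gaps never exceed
  the initial one, so a single constant of the error bound property serves all iterations.

  For a dual solution \<open>y\<close>, first-order optimality over the dual cone together with the bipolar theorem
  makes the minimizer \<open>us\<close> of the Lagrangian at \<open>y\<close> feasible and complementary to \<open>y\<close>, so that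
  \<open>f us = F\<close> (\<open>dual_maximizer_yields_primal\<close>). Since \<open>us\<close> is feasible, its Lagrangian value at \<open>x k\<close>
  is at most \<open>F\<close>; quadratic growth around \<open>u k\<close> then bounds the squared distance of \<open>u k\<close> from \<open>us\<close>
  by \<open>2 / \<sigma>\<close> times the dual gap (\<open>primal_distance_le_dual_gap\<close>). Infeasibility and suboptimality of
  \<open>u k\<close> are linear in that distance (\<open>primal_errors_from_distance\<close>).
\<close>

section \<open>Minimizing strongly convex functions\<close>

lemma strongly_convex_imp_convex_on:
  fixes f :: "'a::real_normed_vector \<Rightarrow> real"
  assumes "strongly_convex \<sigma> f" and "0 < \<sigma>"
  shows "convex_on UNIV f"
proof (rule convex_onI)
  fix t :: real and x y :: 'a
  assume t: "0 < t" "t < 1"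
  have "0 \<le> \<sigma> / 2 * t * (1 - t) * (norm (x - y))\<^sup>2"
    using t assms(2) by simp
  moreover have "f ((1 - t) *\<^sub>R x + t *\<^sub>R y)
      \<le> (1 - t) * f x + t * f y - \<sigma> / 2 * t * (1 - t) * (norm (x - y))\<^sup>2"
    using assms(1) t unfolding strongly_convex_def by auto
  ultimately show "f ((1 - t) *\<^sub>R x + t *\<^sub>R y) \<le> (1 - t) * f x + t * f y"
    by linarith
qed simp

text \<open>
  By continuity, a strongly convex function is bounded below on the unit ball around \<open>a\<close>. For
  a distant point \<open>y\<close>
  of the sublevel set, the segment from \<open>a\<close> to \<open>y\<close> leaves this ball at a point where the function
  undercuts \<open>f a\<close> by at least \<open>\<sigma> / 2 * (norm (a - y) - 1)\<close>, which limits how distant \<open>y\<close> can be.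
\<close>

lemma strongly_convex_sublevel_bounded:
  fixes f :: "'a::euclidean_space \<Rightarrow> real"
  assumes sc: "strongly_convex \<sigma> f" and "0 < \<sigma>"
  shows "bounded {y. f y \<le> f a}"
proof -
  have "continuous_on UNIV f"
    using convex_on_continuous[OF open_UNIV strongly_convex_imp_convex_on[OF assms]] .
  then have "compact (f ` cball a 1)"
    by (metis compact_cball compact_continuous_image continuous_on_subset subset_UNIV)
  then obtain m where m: "\<And>z. z \<in> cball a 1 \<Longrightarrow> m \<le> f z"
    by (metis bounded_imp_bdd_below bdd_below_def compact_imp_bounded image_eqI)
  define R where "R = 1 + 2 * (f a - m) / \<sigma>"
  have "m \<le> f a" using m by simp
  then have R1: "1 \<le> R" using \<open>0 < \<sigma>\<close> by (simp add: R_def)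
  have "y \<in> cball a R" if y: "f y \<le> f a" for y
  proof (cases "norm (a - y) \<le> 1")
    case True
    then show ?thesis using R1 by (simp add: dist_norm)
  next
    case False
    define r where "r = norm (a - y)"
    have r: "1 < r" using False by (simp add: r_def)
    \<comment> \<open>With this weight the convex combination lies on the unit sphere around \<open>a\<close>.\<close>
    define t where "t = 1 / r"
    have t: "0 < t" "t < 1" "t * r = 1" using r by (auto simp: t_def)
    define z where "z = (1 - t) *\<^sub>R a + t *\<^sub>R y"
    have "a - z = t *\<^sub>R (a - y)" by (simp add: z_def algebra_simps)
    then have "dist a z = 1" using t by (simp add: dist_norm r_def)
    then have "m \<le> f z" using m by simp
    also have "f z \<le> (1 - t) * f a + t * f y - \<sigma> / 2 * t * (1 - t) * r\<^sup>2"
      using sc t unfolding strongly_convex_def z_def r_def by auto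
    also have "\<sigma> / 2 * t * (1 - t) * r\<^sup>2 = \<sigma> / 2 * (r - 1)"
    proof -
      have "\<sigma> / 2 * t * (1 - t) * r\<^sup>2 = \<sigma> / 2 * (t * r) * (r - t * r)"
        by (simp add: power2_eq_square algebra_simps)
      then show ?thesis using t by simp
    qed
    also have "(1 - t) * f a + t * f y \<le> f a"
      using mult_left_mono[OF y, of t] t by (simp add: algebra_simps)
    finally have "\<sigma> / 2 * (r - 1) \<le> f a - m" by simp
    then have "r \<le> R" using \<open>0 < \<sigma>\<close> by (simp add: R_def field_simps)
    then show ?thesis by (simp add: dist_norm r_def)
  qed
  then show ?thesis by (intro bounded_subset[OF bounded_cball[of a R]]) auto
qed

lemma strongly_convex_attains_min:
  fixes f :: "'a::euclidean_space \<Rightarrow> real"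
  assumes "strongly_convex \<sigma> f" "0 < \<sigma>" "closed U" "U \<noteq> {}"
  shows "\<exists>u. is_arg_min f (\<lambda>v. v \<in> U) u"
proof -
  obtain a where a: "a \<in> U" using assms(4) by blast
  have cont: "continuous_on UNIV f"
    using convex_on_continuous[OF open_UNIV strongly_convex_imp_convex_on[OF assms(1,2)]] .
  define S where "S = U \<inter> {y. f y \<le> f a}"
  have "closed {y. f y \<le> f a}"
    by (rule closed_Collect_le[OF cont continuous_on_const])
  then have "compact S"
    using strongly_convex_sublevel_bounded[OF assms(1,2), of a] assms(3)
    by (simp add: S_def compact_eq_bounded_closed bounded_Int closed_Int)
  moreover have "a \<in> S" using a by (simp add: S_def)
  ultimately obtain u where "u \<in> S" "\<forall>y\<in>S. f u \<le> f y"
    using continuous_attains_inf[of S f] continuous_on_subset[OF cont] by blast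
  then have "is_arg_min f (\<lambda>v. v \<in> U) u"
    unfolding S_def is_arg_min_linorder by force
  then show ?thesis ..
qed

text \<open>
  Moving from \<open>u\<close> towards \<open>v\<close> cannot decrease \<open>h\<close>, so the strong convexity inequality on the segment
  forces \<open>h v - h u\<close> to dominate \<open>s * (\<sigma> / 2 * (norm (v - u))\<^sup>2)\<close> for every \<open>s < 1\<close>.
\<close>

lemma strongly_convex_quadratic_growth:
  assumes sc: "strongly_convex \<sigma> h" and "convex U"
    and min: "is_arg_min h (\<lambda>v. v \<in> U) u" and v: "v \<in> U"
  shows "h u + \<sigma> / 2 * (norm (v - u))\<^sup>2 \<le> h v"
proof -
  have u: "u \<in> U" and least: "\<And>w. w \<in> U \<Longrightarrow> h u \<le> h w"
    using min by (auto simp: is_arg_min_linorder)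
  have "\<sigma> / 2 * (norm (v - u))\<^sup>2 \<le> h v - h u"
  proof (rule field_le_mult_one_interval)
    fix s :: real
    assume s: "0 < s" "s < 1"
    have "s *\<^sub>R u + (1 - s) *\<^sub>R v \<in> U"
      using \<open>convex U\<close> u v s by (simp add: convex_def)
    then have "h u \<le> h (s *\<^sub>R u + (1 - s) *\<^sub>R v)" by (rule least)
    also have "\<dots> \<le> s * h u + (1 - s) * h v - \<sigma> / 2 * (1 - s) * s * (norm (u - v))\<^sup>2"
      using sc[unfolded strongly_convex_def, rule_format, of "1 - s" u v] s by simp
    finally have "(1 - s) * (s * (\<sigma> / 2 * (norm (v - u))\<^sup>2)) \<le> (1 - s) * (h v - h u)"
      by (simp add: algebra_simps norm_minus_commute)
    then show "s * (\<sigma> / 2 * (norm (v - u))\<^sup>2) \<le> h v - h u"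
      using s by (simp only: mult_le_cancel_left)
  qed
  then show ?thesis by simp
qed

section \<open>Concave functions with a quadratic lower model\<close>

text \<open>
  For a concave function whose gradient is \<open>L\<close>-Lipschitz this holds at every point with \<open>D\<close> the
  gradient: the upper bound expresses concavity, the lower one is the descent lemma. Working with the
  two bounds at one point avoids any reasoning about how the gradient varies.
\<close>

definition quadratic_sandwich :: "real \<Rightarrow> ('a::real_inner \<Rightarrow> real) \<Rightarrow> 'a \<Rightarrow> 'a \<Rightarrow> bool" where
  "quadratic_sandwich L d x D \<longleftrightarrow>
     (\<forall>y. d x + D \<bullet> (y - x) - L / 2 * (norm (y - x))\<^sup>2 \<le> d y \<and> d y \<le> d x + D \<bullet> (y - x))"

lemma quadratic_sandwich_GDERIV:
  assumes "quadratic_sandwich L d x D" and "0 \<le> L"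
  shows "GDERIV d x :> D"
proof -
  have "(\<lambda>h. norm (d (x + h) - d x - h \<bullet> D) / norm h) \<midarrow>0\<rightarrow> 0"
  proof (rule Lim_null_comparison)
    show "\<forall>\<^sub>F h in at 0. norm (norm (d (x + h) - d x - h \<bullet> D) / norm h) \<le> L / 2 * norm h"
    proof -
      have "norm (norm (d (x + h) - d x - h \<bullet> D) / norm h) \<le> L / 2 * norm h"
        if "h \<noteq> 0" for h :: 'a
      proof -
        have "\<bar>d (x + h) - d x - h \<bullet> D\<bar> \<le> L / 2 * (norm h)\<^sup>2"
          using assms(1)[unfolded quadratic_sandwich_def, rule_format, of "x + h"]
          by (simp add: inner_commute)
        then show ?thesis
          using that by (simp add: field_simps power2_eq_square)
      qed
      then show ?thesis by (simp add: eventually_at_filter)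
    qed
    have "((\<lambda>h::'a. L / 2 * norm h) \<longlongrightarrow> L / 2 * norm (0::'a)) (at 0)"
      by (rule tendsto_mult[OF tendsto_const tendsto_norm[OF tendsto_ident_at]])
    then show "((\<lambda>h::'a. L / 2 * norm h) \<longlongrightarrow> 0) (at 0)" by simp
  qed
  then show ?thesis
    unfolding gderiv_def has_derivative_at
    by (simp add: bounded_linear_inner_left)
qed

lemma GDERIV_unique:
  assumes "GDERIV h x :> D" and "GDERIV h x :> E"
  shows "D = E"
proof -
  have "(\<lambda>v. v \<bullet> D) = (\<lambda>v. v \<bullet> E)"
    using assms unfolding gderiv_def by (rule has_derivative_unique)
  then show ?thesis by (metis inner_commute vector_eq_rdot)
qed

lemma gradient_eqI:
  assumes "GDERIV h x :> D"
  shows "gradient h x = D"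
  unfolding gradient_def using assms by (auto intro: GDERIV_unique)

text \<open>
  The lower bound shows that \<open>t * (D \<bullet> z)\<close> is at most of order \<open>t\<^sup>2\<close> as \<open>t\<close> tends to \<open>0\<close>.
\<close>

lemma quadratic_sandwich_maximizer_feasible_direction:
  assumes sw: "quadratic_sandwich L d x D"
    and max: "\<And>t. 0 < t \<Longrightarrow> t < 1 \<Longrightarrow> d (x + t *\<^sub>R z) \<le> d x"
  shows "D \<bullet> z \<le> 0"
proof -
  have bound: "D \<bullet> z \<le> t * (L / 2 * (norm z)\<^sup>2)" if t: "0 < t" "t < 1" for t
  proof -
    have "d x + t * (D \<bullet> z) - L / 2 * (t * norm z)\<^sup>2 \<le> d x"
      using sw[unfolded quadratic_sandwich_def, rule_format, of "x + t *\<^sub>R z"] max[OF t] t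
      by simp
    then have "t * (D \<bullet> z) \<le> t * (t * (L / 2 * (norm z)\<^sup>2))"
      by (simp add: power2_eq_square algebra_simps)
    then show ?thesis using t by simp
  qed
  have "((\<lambda>t. t * (L / 2 * (norm z)\<^sup>2)) \<longlongrightarrow> 0 * (L / 2 * (norm z)\<^sup>2)) (at_right 0)"
    by (intro tendsto_intros)
  moreover have "\<forall>\<^sub>F t in at_right 0. D \<bullet> z \<le> t * (L / 2 * (norm z)\<^sup>2)"
    using bound unfolding eventually_at_right_field by (intro exI[of _ 1]) auto
  ultimately show ?thesis
    using tendsto_lowerbound[of _ 0 "at_right (0::real)"] by force
qed

section \<open>One projected gradient step\<close>

text \<open>
  The upper bound of the sandwich at \<open>y\<close> and the lower one at \<open>xp\<close> leave
  \<open>D \<bullet> (y - xp) + L / 2 * (norm (xp - x))\<^sup>2\<close> to be estimated; the obtuse-angle property of the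
  projection replaces \<open>D\<close> by \<open>L *\<^sub>R (xp - x)\<close> there, and completing the square gives the difference of
  squared distances.
\<close>

lemma projected_gradient_three_point:
  fixes d :: "'a::euclidean_space \<Rightarrow> real"
  assumes sw: "quadratic_sandwich L d x D" and L: "0 < L"
    and C: "convex C" "closed C" "y \<in> C"
    and xp: "xp = closest_point C (x + (1 / L) *\<^sub>R D)"
  shows "d y - d xp \<le> L / 2 * ((norm (x - y))\<^sup>2 - (norm (xp - y))\<^sup>2)"
proof -
  define s where "s = xp - x"
  define e where "e = y - x"
  have "((1 / L) *\<^sub>R D - s) \<bullet> (e - s) \<le> 0"
    using closest_point_dot[OF C, of "x + (1 / L) *\<^sub>R D"]
    by (simp add: xp s_def e_def algebra_simps)
  then have "(1 / L) * (D \<bullet> (e - s)) \<le> s \<bullet> (e - s)"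
    by (simp add: inner_diff_left)
  then have "D \<bullet> (e - s) \<le> L * (s \<bullet> (e - s))"
    using L by (simp add: field_simps)
  moreover have "d y \<le> d x + D \<bullet> e" "d x + D \<bullet> s - L / 2 * (norm s)\<^sup>2 \<le> d xp"
    using sw unfolding quadratic_sandwich_def s_def e_def by auto
  ultimately have "d y - d xp \<le> L * (s \<bullet> (e - s)) + L / 2 * (norm s)\<^sup>2"
    by (simp add: inner_diff_right)
  also have "\<dots> = L / 2 * ((norm e)\<^sup>2 - (norm (s - e))\<^sup>2)"
    by (simp add: power2_norm_eq_inner algebra_simps inner_commute)
  finally show ?thesis
    by (simp add: s_def e_def norm_minus_commute)
qed

text \<open>
  The three-point inequality at \<open>x\<close> itself says that the step gains at least
  \<open>L / 2 * (norm (xp - x))\<^sup>2\<close>. At \<open>y\<close>, combined with the error bound, it says that the remaining gap is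
  at most \<open>2 * \<kappa>\<close> times that quantity. Hence the remaining gap is at most \<open>2 * \<kappa>\<close> times the gain.
\<close>

lemma projected_gradient_contraction:
  fixes d :: "'a::euclidean_space \<Rightarrow> real"
  assumes sw: "quadratic_sandwich L d x D" and L: "0 < L"
    and C: "convex C" "closed C" "x \<in> C" "y \<in> C"
    and xp: "xp = closest_point C (x + (1 / L) *\<^sub>R D)"
    and eb: "norm (x - y) \<le> \<kappa> * norm (xp - x)" and "0 < \<kappa>"
  shows "d y - d xp \<le> 2 * \<kappa> / (1 + 2 * \<kappa>) * (d y - d x)"
proof -
  have ascent: "d x - d xp \<le> - (L / 2 * (norm (xp - x))\<^sup>2)"
    using projected_gradient_three_point[OF sw L C(1,2,3) xp] by simp
  have "(norm (x - y))\<^sup>2 - (norm (xp - y))\<^sup>2 \<le> 2 * (norm (x - y) * norm (xp - x))"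
  proof -
    have "(norm (x - y))\<^sup>2 - (norm (xp - y))\<^sup>2
        = 2 * ((y - x) \<bullet> (xp - x)) - (norm (xp - x))\<^sup>2"
      by (simp add: power2_norm_eq_inner algebra_simps inner_commute)
    also have "\<dots> \<le> 2 * (norm (y - x) * norm (xp - x))"
      using norm_cauchy_schwarz[of "y - x" "xp - x"] zero_le_power2[of "norm (xp - x)"]
      by linarith
    finally show ?thesis by (simp add: norm_minus_commute)
  qed
  also have "\<dots> \<le> 2 * (\<kappa> * norm (xp - x) * norm (xp - x))"
    using eb by (intro mult_left_mono mult_right_mono) auto
  finally have "L / 2 * ((norm (x - y))\<^sup>2 - (norm (xp - y))\<^sup>2)
      \<le> L / 2 * (2 * (\<kappa> * norm (xp - x) * norm (xp - x)))"
    using L by (intro mult_left_mono) auto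
  with projected_gradient_three_point[OF sw L C(1,2,4) xp]
  have "d y - d xp \<le> 2 * \<kappa> * (L / 2 * (norm (xp - x))\<^sup>2)"
    by (simp add: power2_eq_square algebra_simps)
  also have "\<dots> \<le> 2 * \<kappa> * (d xp - d x)"
    using ascent \<open>0 < \<kappa>\<close> by (intro mult_left_mono) auto
  finally have "(1 + 2 * \<kappa>) * (d y - d xp) \<le> 2 * \<kappa> * (d y - d x)"
    by (simp add: algebra_simps)
  then show ?thesis
    using \<open>0 < \<kappa>\<close> by (simp add: pos_le_divide_eq mult.commute)
qed

section \<open>Dual cones\<close>

lemma dual_cone_closed: "closed (dual_cone K)"
proof -
  have "dual_cone K = (\<Inter>z\<in>K. {x. 0 \<le> z \<bullet> x})"
    by (auto simp: dual_cone_def inner_commute)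
  then show ?thesis by (simp add: closed_halfspace_ge closed_INT)
qed

lemma dual_cone_convex: "convex (dual_cone K)"
  by (auto simp: convex_def dual_cone_def inner_add_left)

lemma dual_cone_scale_add:
  assumes "x \<in> dual_cone K" "z \<in> dual_cone K" "0 \<le> t"
  shows "x + t *\<^sub>R z \<in> dual_cone K"
  using assms by (auto simp: dual_cone_def inner_add_left)

text \<open>
  This is the nontrivial half of the bipolar theorem: a functional separating \<open>w\<close> from \<open>K\<close> is bounded
  below on a cone, hence nonnegative on it, and so belongs to the dual cone.
\<close>

lemma bidual_cone_subset:
  fixes K :: "'a::euclidean_space set"
  assumes K: "cone K" "closed K" "convex K" "K \<noteq> {}"
    and w: "\<And>z. z \<in> dual_cone K \<Longrightarrow> 0 \<le> z \<bullet> w"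
  shows "w \<in> K"
proof (rule ccontr)
  assume "w \<notin> K"
  then obtain a b where ab: "a \<bullet> w < b" "\<And>z. z \<in> K \<Longrightarrow> b < a \<bullet> z"
    using separating_hyperplane_closed_point[OF K(3,2)] by blast
  have "0 \<in> K" using K(1,4) cone_contains_0 by blast
  then have b: "b < 0" using ab(2) by force
  have "0 \<le> a \<bullet> z" if z: "z \<in> K" for z
  proof (rule ccontr)
    assume neg: "\<not> 0 \<le> a \<bullet> z"
    \<comment> \<open>This multiple of \<open>z\<close> lies on the separating hyperplane, which \<open>K\<close> does not meet.\<close>
    then have "(b / (a \<bullet> z)) *\<^sub>R z \<in> K"
      using K(1) z b by (intro mem_cone) (auto intro: divide_nonpos_nonpos)
    from ab(2)[OF this] show False using neg by simp
  qed
  then have "a \<in> dual_cone K" by (simp add: dual_cone_def)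
  then show False using w ab(1) b by force
qed

section \<open>The dual function\<close>

lemma lagrangian_strongly_convex:
  assumes "strongly_convex \<sigma> f"
  shows "strongly_convex \<sigma> (\<lambda>u. lagrangian f G g u x)"
  unfolding strongly_convex_def
proof (intro allI ballI)
  fix a b and t :: real
  assume "t \<in> {0..1}"
  then have "f ((1 - t) *\<^sub>R a + t *\<^sub>R b)
      \<le> (1 - t) * f a + t * f b - \<sigma> / 2 * t * (1 - t) * (norm (a - b))\<^sup>2"
    using assms by (simp add: strongly_convex_def)
  moreover have "G *v ((1 - t) *\<^sub>R a + t *\<^sub>R b) + g
      = (1 - t) *\<^sub>R (G *v a + g) + t *\<^sub>R (G *v b + g)"
    by (simp add: matrix_vector_right_distrib matrix_vector_mult_scaleR algebra_simps)
  ultimately show "lagrangian f G g ((1 - t) *\<^sub>R a + t *\<^sub>R b) x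
      \<le> (1 - t) * lagrangian f G g a x + t * lagrangian f G g b x
        - \<sigma> / 2 * t * (1 - t) * (norm (a - b))\<^sup>2"
    by (simp add: lagrangian_def inner_add_right right_diff_distrib)
qed

lemma dual_fun_eq_lagrangian:
  assumes "is_arg_min (\<lambda>v. lagrangian f G g v x) (\<lambda>v. v \<in> U) u"
  shows "dual_fun f G g U x = lagrangian f G g u x"
  unfolding dual_fun_def
  using assms by (intro cInf_eq_minimum) (auto simp: is_arg_min_linorder)

text \<open>
  The upper bound tests the Lagrangian at \<open>y\<close> with the minimizer \<open>u\<close> at \<open>x\<close>. For the lower bound,
  moving from \<open>u\<close> to the minimizer \<open>v\<close> at \<open>y\<close> costs \<open>\<sigma> / 2 * (norm (v - u))\<^sup>2\<close> by quadratic growth and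
  gains at most \<open>norm (y - x) * onorm ((*v) G) * norm (v - u)\<close>; the best trade-off between the two is
  the quadratic term with \<open>lip_dual \<sigma> G\<close>.
\<close>

lemma dual_fun_sandwich:
  fixes G :: "real^'n^'p"
  assumes sc: "strongly_convex \<sigma> f" and "0 < \<sigma>" and U: "closed U" "convex U"
    and u: "is_arg_min (\<lambda>v. lagrangian f G g v x) (\<lambda>v. v \<in> U) u"
  shows "quadratic_sandwich (lip_dual \<sigma> G) (dual_fun f G g U) x (- (G *v u + g))"
  unfolding quadratic_sandwich_def
proof (intro allI conjI)
  fix y
  have uU: "u \<in> U" using u by (simp add: is_arg_min_linorder)
  obtain v where v: "is_arg_min (\<lambda>v. lagrangian f G g v y) (\<lambda>v. v \<in> U) v"
    using strongly_convex_attains_min[OF lagrangian_strongly_convex[OF sc] \<open>0 < \<sigma>\<close> U(1)] uU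
    by blast
  have dx: "dual_fun f G g U x = lagrangian f G g u x"
    and dy: "dual_fun f G g U y = lagrangian f G g v y"
    using u v by (simp_all add: dual_fun_eq_lagrangian)
  have "lagrangian f G g v y \<le> lagrangian f G g u y"
    using v uU by (simp add: is_arg_min_linorder)
  also have "\<dots> = lagrangian f G g u x + - (G *v u + g) \<bullet> (y - x)"
    by (simp add: lagrangian_def algebra_simps inner_commute)
  finally show "dual_fun f G g U y \<le> dual_fun f G g U x + - (G *v u + g) \<bullet> (y - x)"
    using dx dy by simp
  have vU: "v \<in> U" using v by (simp add: is_arg_min_linorder)
  define N where "N = onorm ((*v) G)"
  define r where "r = norm (v - u)"
  define s where "s = norm (y - x)"
  have growth: "lagrangian f G g u x + \<sigma> / 2 * r\<^sup>2 \<le> lagrangian f G g v x"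
    unfolding r_def
    using strongly_convex_quadratic_growth[OF lagrangian_strongly_convex[OF sc] U(2) u vU] .
  have "(y - x) \<bullet> (G *v (v - u)) \<le> s * norm (G *v (v - u))"
    unfolding s_def by (rule norm_cauchy_schwarz)
  also have "\<dots> \<le> s * (N * r)"
    unfolding N_def r_def
    by (intro mult_left_mono onorm) (auto simp: s_def matrix_vector_mul_bounded_linear)
  finally have cross: "(y - x) \<bullet> (G *v (v - u)) \<le> s * (N * r)" .
  have young: "s * (N * r) \<le> \<sigma> / 2 * r\<^sup>2 + lip_dual \<sigma> G / 2 * s\<^sup>2"
  proof -
    have "0 \<le> (\<sigma> * r - N * s)\<^sup>2 / (2 * \<sigma>)" using \<open>0 < \<sigma>\<close> by simp
    also have "\<dots> = \<sigma> / 2 * r\<^sup>2 + N\<^sup>2 / \<sigma> / 2 * s\<^sup>2 - s * (N * r)"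
      using \<open>0 < \<sigma>\<close> by (simp add: field_simps power2_eq_square)
    finally show ?thesis by (simp add: lip_dual_def N_def)
  qed
  have "lagrangian f G g v y
      = lagrangian f G g v x - (G *v u + g) \<bullet> (y - x) - (y - x) \<bullet> (G *v (v - u))"
    by (simp add: lagrangian_def matrix_vector_mult_diff_distrib algebra_simps inner_commute)
  then show "dual_fun f G g U x + - (G *v u + g) \<bullet> (y - x)
      - lip_dual \<sigma> G / 2 * (norm (y - x))\<^sup>2 \<le> dual_fun f G g U y"
    unfolding inner_minus_left using growth cross young dx dy s_def by simp
qed

lemma dual_fun_continuous:
  fixes G :: "real^'n^'p"
  assumes "strongly_convex \<sigma> f" "0 < \<sigma>" "closed U" "convex U" "U \<noteq> {}"
  shows "continuous_on UNIV (dual_fun f G g U)"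
proof (intro continuous_at_imp_continuous_on ballI)
  fix x
  obtain u where "is_arg_min (\<lambda>v. lagrangian f G g v x) (\<lambda>v. v \<in> U) u"
    using strongly_convex_attains_min[OF lagrangian_strongly_convex] assms by blast
  then have "GDERIV (dual_fun f G g U) x :> - (G *v u + g)"
    using dual_fun_sandwich[OF assms(1-4)] quadratic_sandwich_GDERIV assms(2)
    by (fastforce simp: lip_dual_def)
  then show "isCont (dual_fun f G g U) x"
    unfolding gderiv_def by (rule has_derivative_continuous)
qed

text \<open>
  Closedness is what places \<open>closest_point (dual_opt_set f G g K U) z\<close> in the solution set.
\<close>

lemma dual_opt_set_closed:
  fixes G :: "real^'n^'p"
  assumes "continuous_on UNIV (dual_fun f G g U)"
  shows "closed (dual_opt_set f G g K U)"
proof (cases "dual_opt_set f G g K U = {}")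
  case False
  then obtain y where y: "y \<in> dual_opt_set f G g K U" by blast
  then have "dual_opt_set f G g K U
      = dual_cone K \<inter> {x. dual_fun f G g U y \<le> dual_fun f G g U x}"
    by (auto simp: dual_opt_set_def is_arg_max_linorder intro: order_trans)
  then show ?thesis
    by (simp add: closed_Int dual_cone_closed closed_Collect_le assms)
qed simp

lemma lip_dual_pos:
  fixes G :: "real^'n^'p"
  assumes "G \<noteq> 0" "0 < \<sigma>"
  shows "0 < lip_dual \<sigma> G"
proof -
  have "\<exists>v. G *v v \<noteq> 0" using assms(1) by (metis matrix_eq matrix_vector_mult_0)
  then have "0 < onorm ((*v) G)"
    using onorm_pos_lt[OF matrix_vector_mul_bounded_linear] by blast
  then show ?thesis using assms(2) by (simp add: lip_dual_def)
qed

section \<open>Recovering a primal solution\<close>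

text \<open>
  First-order optimality of \<open>y\<close> over the dual cone, in the directions \<open>z\<close> of the cone and in the
  direction \<open>- y\<close> towards the apex. The former put the constraint value into the bidual of \<open>K\<close>, which
  is \<open>K\<close>; the latter gives complementary slackness.
\<close>

lemma dual_maximizer_yields_primal:
  fixes G :: "real^'n^'p"
  assumes K: "proper_cone K"
    and max: "y \<in> dual_opt_set f G g K U"
    and sw: "quadratic_sandwich L (dual_fun f G g U) y (- (G *v u + g))"
  shows "G *v u + g \<in> K" and "y \<bullet> (G *v u + g) = 0"
proof -
  define w where "w = G *v u + g"
  have y: "y \<in> dual_cone K"
    and le: "\<And>z. z \<in> dual_cone K \<Longrightarrow> dual_fun f G g U z \<le> dual_fun f G g U y"
    using max by (auto simp: dual_opt_set_def is_arg_max_linorder)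
  have "0 \<le> z \<bullet> w" if "z \<in> dual_cone K" for z
  proof -
    have "- w \<bullet> z \<le> 0"
      unfolding w_def using dual_cone_scale_add[OF y that]
      by (intro quadratic_sandwich_maximizer_feasible_direction[OF sw] le) simp
    then show ?thesis by (simp add: inner_commute)
  qed
  moreover have K0: "cone K" "closed K" "convex K" "K \<noteq> {}"
    using K by (auto simp: proper_cone_def)
  ultimately have "w \<in> K" using bidual_cone_subset by blast
  moreover have "y \<bullet> w \<le> 0"
  proof -
    have "y + t *\<^sub>R - y \<in> dual_cone K" if "0 < t" "t < 1" for t :: real
    proof -
      have "0 \<le> (1 - t) * (y \<bullet> z)" if "z \<in> K" for z
        using that \<open>t < 1\<close> y by (simp add: dual_cone_def)
      then show ?thesis by (simp add: dual_cone_def algebra_simps)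
    qed
    then have "- w \<bullet> - y \<le> 0"
      unfolding w_def
      by (intro quadratic_sandwich_maximizer_feasible_direction[OF sw] le)
    then show ?thesis by (simp add: inner_commute)
  qed
  moreover have "0 \<le> y \<bullet> w"
    using y \<open>w \<in> K\<close> by (simp add: dual_cone_def)
  ultimately show "G *v u + g \<in> K" "y \<bullet> (G *v u + g) = 0"
    by (simp_all add: w_def)
qed

text \<open>
  Saddle-point comparisons replace a Lipschitz constant of \<open>f\<close>. Testing the Lagrangian at \<open>y\<close> with \<open>u\<close>
  bounds \<open>f u\<close> from below, and testing the one at \<open>x\<close> with \<open>us\<close> bounds it from above; in both cases
  the difference is an inner product of the multiplier with \<open>G *v (u - us)\<close>. This is why the upper
  bound involves \<open>norm x\<close>.
\<close>

lemma primal_errors_from_distance: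
  fixes G :: "real^'n^'p"
  assumes us: "us \<in> U" "G *v us + g \<in> K" "y \<bullet> (G *v us + g) = 0"
    and y: "y \<in> dual_cone K" "dual_fun f G g U y = F"
    and min_y: "is_arg_min (\<lambda>v. lagrangian f G g v y) (\<lambda>v. v \<in> U) us"
    and min_x: "is_arg_min (\<lambda>v. lagrangian f G g v x) (\<lambda>v. v \<in> U) u"
  defines "\<rho> \<equiv> onorm ((*v) G) * norm (u - us)"
  shows "infdist (G *v u + g) K \<le> \<rho>" and "- (norm y * \<rho>) \<le> f u - F"
    and "f u - F \<le> norm x * \<rho>"
proof -
  have G_le: "norm (G *v (u - us)) \<le> \<rho>"
    unfolding \<rho>_def by (rule onorm[OF matrix_vector_mul_bounded_linear])
  then have split: "\<bar>z \<bullet> (G *v u + g) - z \<bullet> (G *v us + g)\<bar> \<le> norm z * \<rho>" for z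
  proof -
    have "z \<bullet> (G *v u + g) - z \<bullet> (G *v us + g) = z \<bullet> (G *v (u - us))"
      by (simp add: matrix_vector_mult_diff_distrib inner_add_right inner_diff_right)
    then have "\<bar>z \<bullet> (G *v u + g) - z \<bullet> (G *v us + g)\<bar> \<le> norm z * norm (G *v (u - us))"
      using Cauchy_Schwarz_ineq2 by metis
    also have "\<dots> \<le> norm z * \<rho>" using G_le by (intro mult_left_mono) auto
    finally show ?thesis .
  qed
  have "dist (G *v u + g) (G *v us + g) \<le> \<rho>"
    using G_le by (simp add: dist_norm matrix_vector_mult_diff_distrib)
  with us(2) show "infdist (G *v u + g) K \<le> \<rho>" by (rule infdist_le2)
  have F: "F = f us"
    using dual_fun_eq_lagrangian[OF min_y] y(2) us(3) by (simp add: lagrangian_def)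
  have uU: "u \<in> U" using min_x by (simp add: is_arg_min_linorder)
  have "F \<le> f u - y \<bullet> (G *v u + g)"
    using min_y uU dual_fun_eq_lagrangian[OF min_y] y(2)
    by (simp add: is_arg_min_linorder lagrangian_def)
  then show "- (norm y * \<rho>) \<le> f u - F" using split[of y] us(3) by linarith
  have "f u - x \<bullet> (G *v u + g) \<le> f us - x \<bullet> (G *v us + g)"
    using min_x us(1) by (simp add: is_arg_min_linorder lagrangian_def)
  then show "f u - F \<le> norm x * \<rho>" using split[of x] F by linarith
qed

lemma primal_distance_le_dual_gap:
  fixes G :: "real^'n^'p"
  assumes "strongly_convex \<sigma> f" "convex U"
    and us: "us \<in> U" "G *v us + g \<in> K"
    and x: "x \<in> dual_cone K"
    and min_x: "is_arg_min (\<lambda>v. lagrangian f G g v x) (\<lambda>v. v \<in> U) u"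
  shows "\<sigma> / 2 * (norm (u - us))\<^sup>2 \<le> f us - dual_fun f G g U x"
proof -
  have "lagrangian f G g u x + \<sigma> / 2 * (norm (us - u))\<^sup>2 \<le> lagrangian f G g us x"
    by (rule strongly_convex_quadratic_growth[OF lagrangian_strongly_convex assms(2)])
      (use assms in auto)
  moreover have "lagrangian f G g us x \<le> f us"
    using x us(2) by (simp add: dual_cone_def lagrangian_def)
  ultimately show ?thesis
    using dual_fun_eq_lagrangian[OF min_x] by (simp add: norm_minus_commute)
qed

section \<open>Linear convergence of the last primal iterate\<close>

text \<open>
  With \<open>q\<close> the contraction factor of the dual gap, the primal errors are of order \<open>sqrt (q ^ k)\<close>. This
  is at most \<open>\<epsilon>\<close> once \<open>k * ln (1 / q)\<close> reaches \<open>2 * ln (1 / \<epsilon>)\<close>, which dictates the choice of \<open>C1\<close>.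
\<close>

theorem theorem5p3:
  fixes f :: "real^'n \<Rightarrow> real" and \<sigma> :: real
    and G :: "real^'n^'p" and g :: "real^'p"
    and K :: "(real^'p) set" and U :: "(real^'n) set"
    and x :: "nat \<Rightarrow> real^'p" and u :: "nat \<Rightarrow> real^'n"
  assumes "\<sigma> > 0" and "strongly_convex \<sigma> f"
    and "G \<noteq> 0"
    and "proper_cone K"
    and "U \<noteq> {}" and "closed U" and "convex U"
    and multiplier: "\<exists>y\<in>dual_opt_set f G g K U. dual_fun f G g U y = opt_val f G g K U"
    and "error_bound_property \<sigma> f G g K U"
    and "DG_iterates \<sigma> f G g K U x u"
  shows "\<exists>C\<^sub>1>0. \<exists>C\<^sub>2>0. \<forall>\<epsilon>\<in>{0<..<1}. \<forall>k\<ge>1.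
           real k \<ge> C\<^sub>1 * ln (1 / \<epsilon>) \<longrightarrow> primal_solution f G g K U C\<^sub>2 \<epsilon> (u k)"
proof -
  define L where "L = lip_dual \<sigma> G"
  define N where "N = onorm ((*v) G)"
  define d where "d = dual_fun f G g U"
  define F where "F = opt_val f G g K U"
  define X where "X = dual_opt_set f G g K U"
  define D where "D = dual_cone K"
  have L: "0 < L" unfolding L_def using assms(1,3) by (rule lip_dual_pos[rotated])
  have N: "0 \<le> N" unfolding N_def by (rule onorm_pos_le[OF matrix_vector_mul_bounded_linear])
  have closed_D: "closed D" and convex_D: "convex D"
    by (simp_all add: D_def dual_cone_closed dual_cone_convex)
  obtain y where yX: "y \<in> X" and dy: "d y = F"
    using multiplier unfolding X_def d_def F_def by blast
  have X: "z \<in> X \<longleftrightarrow> z \<in> D \<and> (\<forall>w\<in>D. d w \<le> d z)" for z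
    by (auto simp: X_def D_def d_def dual_opt_set_def is_arg_max_linorder)
  have yD: "y \<in> D" and le_F: "\<And>z. z \<in> D \<Longrightarrow> d z \<le> F" using yX dy X by auto
  have F_on_X: "d z = F" if "z \<in> X" for z
    using that yX dy X by (meson order_antisym)
  have "closed X"
    unfolding X_def using assms(1,2,5-7) by (intro dual_opt_set_closed dual_fun_continuous)

  have x0: "x 0 \<in> D" and min: "is_arg_min (\<lambda>v. lagrangian f G g v (x k)) (\<lambda>v. v \<in> U) (u k)"
    and step: "x (Suc k) = dual_gradient_step \<sigma> f G g K U (x k)" for k
    using assms(10) by (auto simp: DG_iterates_def D_def)
  define p where "p k = - (G *v u k + g)" for k
  have sw: "quadratic_sandwich L d (x k) (p k)" for k
    unfolding L_def d_def p_def
    by (rule dual_fun_sandwich[OF assms(2,1,6,7) min])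
  have "gradient d (x k) = p k" for k
    using quadratic_sandwich_GDERIV[OF sw] L by (simp add: gradient_eqI)
  then have proj: "x (Suc k) = closest_point D (x k + (1 / L) *\<^sub>R p k)" for k
    using step by (simp add: dual_gradient_step_def d_def L_def D_def)
  have xD: "x k \<in> D" for k
    using x0 proj closest_point_in_set[OF closed_D] yD by (cases k) auto

  have gap_le: "d y - d (x (Suc k)) \<le> L / 2 * ((norm (x k - y))\<^sup>2 - (norm (x (Suc k) - y))\<^sup>2)"
    and ascent: "d (x k) - d (x (Suc k))
      \<le> L / 2 * ((norm (x k - x k))\<^sup>2 - (norm (x (Suc k) - x k))\<^sup>2)" for k
    using projected_gradient_three_point[OF sw L convex_D closed_D _ proj] yD xD by blast+
  have mono: "F - d (x (Suc k)) \<le> F - d (x k)" for k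
    using ascent[of k] L zero_le_power2[of "norm (x (Suc k) - x k)"]
    by (smt (verit) diff_self mult_nonneg_nonneg norm_zero power_zero_numeral mult_minus_right half_gt_zero)
  \<comment> \<open>The distance to the dual solution \<open>y\<close> never increases. This bounds the factor \<open>norm (x k)\<close>
     in the upper estimate of the objective error.\<close>
  have "norm (x (Suc k) - y) \<le> norm (x k - y)" for k
  proof -
    have "0 \<le> L / 2 * ((norm (x k - y))\<^sup>2 - (norm (x (Suc k) - y))\<^sup>2)"
      using gap_le[of k] le_F[OF xD[of "Suc k"]] dy by linarith
    then show ?thesis
      using L by (simp add: zero_le_mult_iff power2_le_iff_abs_le)
  qed
  then have "norm (x k - y) \<le> norm (x 0 - y)" for k
    by (induction k) (auto intro: order_trans)
  then have x_bound: "norm (x k) \<le> norm y + norm (x 0 - y)" for k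
    using norm_triangle_ineq2[of "x k" y] by (smt (verit))

  \<comment> \<open>The added \<open>1\<close> keeps \<open>M\<close> positive when the starting point is already optimal.\<close>
  define M where "M = F - d (x 0) + 1"
  have "0 < M" using le_F[OF x0] by (simp add: M_def)
  then obtain \<kappa> where \<kappa>: "0 < \<kappa>" and eb: "\<And>z. z \<in> D \<Longrightarrow> F - d z \<le> M \<Longrightarrow>
      norm (z - closest_point X z) \<le> \<kappa> * norm (gradient_map \<sigma> f G g K U z)"
    using assms(9) unfolding error_bound_property_def D_def F_def d_def X_def by blast
  define q where "q = 2 * \<kappa> / (1 + 2 * \<kappa>)"
  have q: "0 < q" "q < 1" using \<kappa> by (auto simp: q_def)
  have gap_le_initial: "F - d (x k) \<le> F - d (x 0)" for k
    by (induction k) (use mono in \<open>auto intro: order_trans\<close>)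
  have contract: "F - d (x (Suc k)) \<le> q * (F - d (x k))" for k
  proof -
    define z where "z = closest_point X (x k)"
    have z: "z \<in> X" unfolding z_def using closest_point_in_set[OF \<open>closed X\<close>] yX by blast
    have "norm (x k - z) \<le> \<kappa> * norm (x (Suc k) - x k)"
      using eb[OF xD, of k] gap_le_initial[of k] by (simp add: z_def M_def gradient_map_def step)
    then have "d z - d (x (Suc k)) \<le> q * (d z - d (x k))"
      unfolding q_def
      using projected_gradient_contraction[OF sw L convex_D closed_D xD _ proj _ \<kappa>] z X by blast
    then show ?thesis using F_on_X[OF z] by simp
  qed
  define \<Delta> where "\<Delta> = F - d (x 0)"
  have \<Delta>: "0 \<le> \<Delta>" using le_F[OF x0] by (simp add: \<Delta>_def)
  have rate: "F - d (x k) \<le> q ^ k * \<Delta>" for k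
  proof (induction k)
    case (Suc k)
    have "F - d (x (Suc k)) \<le> q * (F - d (x k))" by (rule contract)
    also have "\<dots> \<le> q * (q ^ k * \<Delta>)" using Suc q by (intro mult_left_mono) auto
    finally show ?case by (simp add: mult.assoc)
  qed (simp add: \<Delta>_def)

  obtain us where us: "is_arg_min (\<lambda>v. lagrangian f G g v y) (\<lambda>v. v \<in> U) us"
    using strongly_convex_attains_min[OF lagrangian_strongly_convex[OF assms(2)] assms(1,6,5)]
    by blast
  have usU: "us \<in> U" using us by (simp add: is_arg_min_linorder)
  note opt = dual_maximizer_yields_primal[OF assms(4) yX[unfolded X_def]
      dual_fun_sandwich[OF assms(2,1,6,7) us]]
  have f_us: "f us = F"
    using dual_fun_eq_lagrangian[OF us] dy opt(2) by (simp add: lagrangian_def d_def)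
  note errors = primal_errors_from_distance[OF usU opt yD[unfolded D_def] dy[unfolded d_def] us min]

  define B where "B = N * sqrt (2 * \<Delta> / \<sigma>)"
  \<comment> \<open>\<open>R\<close> dominates the three factors of \<open>\<rho>\<close> in the primal errors: \<open>1\<close>, \<open>norm y\<close> and \<open>norm (x k)\<close>.\<close>
  define R where "R = 1 + norm y + norm (x 0 - y)"
  define C1 where "C1 = 2 / ln (1 / q)"
  define C2 where "C2 = R * B + 1"
  have B: "0 \<le> B" using N \<Delta> assms(1) by (simp add: B_def)
  have R: "1 \<le> R" "norm y \<le> R" "norm (x k) \<le> R" for k
    using x_bound[of k] by (auto simp: R_def)
  have "0 < C1" using q by (simp add: C1_def)
  moreover have "0 < C2" using B R(1) by (simp add: C2_def add_nonneg_pos)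
  moreover have "primal_solution f G g K U C2 \<epsilon> (u k)"
    if \<epsilon>: "\<epsilon> \<in> {0<..<1}" and k: "real k \<ge> C1 * ln (1 / \<epsilon>)" for \<epsilon> k
  proof -
    have "q ^ k \<le> \<epsilon>\<^sup>2"
    proof -
      have lnq: "ln q < 0" using q by simp
      have "2 * ln (1 / \<epsilon>) \<le> real k * ln (1 / q)"
        using k q by (simp add: C1_def pos_divide_le_eq)
      then have "real k * ln q \<le> 2 * ln \<epsilon>"
        using \<epsilon> q by (simp add: ln_div)
      then have "ln (q ^ k) \<le> ln (\<epsilon>\<^sup>2)"
        using \<epsilon> q by (simp add: ln_realpow)
      then show ?thesis using \<epsilon> q by simp
    qed
    define \<rho> where "\<rho> = N * norm (u k - us)"
    have "\<sigma> / 2 * (norm (u k - us))\<^sup>2 \<le> F - d (x k)"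
      using primal_distance_le_dual_gap[OF assms(2,7) usU opt(1) xD[unfolded D_def] min] f_us
      by (simp add: d_def)
    also have "\<dots> \<le> \<epsilon>\<^sup>2 * \<Delta>"
      using rate[of k] mult_right_mono[OF \<open>q ^ k \<le> \<epsilon>\<^sup>2\<close> \<Delta>] by linarith
    finally have "(norm (u k - us))\<^sup>2 \<le> \<epsilon>\<^sup>2 * (2 * \<Delta> / \<sigma>)"
      using assms(1) by (simp add: field_simps)
    then have "norm (u k - us) \<le> \<epsilon> * sqrt (2 * \<Delta> / \<sigma>)"
      using \<epsilon> real_le_rsqrt[of "norm (u k - us)" "\<epsilon>\<^sup>2 * (2 * \<Delta> / \<sigma>)"]
      unfolding real_sqrt_mult[of "\<epsilon>\<^sup>2"] by simp
    then have "\<rho> \<le> N * (\<epsilon> * sqrt (2 * \<Delta> / \<sigma>))"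
      unfolding \<rho>_def using N by (rule mult_left_mono)
    then have \<rho>: "\<rho> \<le> B * \<epsilon>" by (simp add: B_def mult_ac)
    have "0 \<le> \<rho>" using N by (simp add: \<rho>_def)
    have C2: "c * \<rho> \<le> C2 * \<epsilon>" if "0 \<le> c" "c \<le> R" for c
    proof -
      have "c * \<rho> \<le> R * (B * \<epsilon>)" using that \<rho> \<open>0 \<le> \<rho>\<close> R(1) by (intro mult_mono) auto
      also have "\<dots> \<le> C2 * \<epsilon>" using \<epsilon> by (simp add: C2_def algebra_simps)
      finally show ?thesis .
    qed
    have "u k \<in> U" using min by (simp add: is_arg_min_linorder)
    moreover have "infdist (G *v u k + g) K \<le> C2 * \<epsilon>"
      using errors(1)[of k] C2[of 1] R(1) by (simp add: \<rho>_def N_def)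
    moreover have "- (C2 * \<epsilon>) \<le> f (u k) - F"
      using errors(2)[of k] C2[of "norm y"] R(2) by (simp add: \<rho>_def N_def)
    moreover have "f (u k) - F \<le> C2 * \<epsilon>"
      using errors(3)[of k] C2[of "norm (x k)"] R(3) by (simp add: \<rho>_def N_def)
    ultimately show ?thesis by (simp add: primal_solution_def F_def)
  qed
  ultimately show ?thesis by blast
qed

end
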